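(* Let $(X,\mu,m)$ be a connected weighted graph which admits a compatible intrinsic metric $\rho$, let $o\in X$ be a fixed vertex and $\rho_1=1\vee\rho(\cdot,o)$. If a non-negative subharmonic function $f$ satisfies $$f\in L^p(X,m\rho_1^{-2})$$ for some $p\in(1,\infty)$, then $f$ is constant.
   Context: Weighted graph: $X$ is a countable discrete set, $m:X\to(0,\infty)$ is extended additively to a measure on all subsets of $X$, and $\mu:X\times X\to[0,\infty)$, $(x,y)\mapsto\mu_{xy}$, is symmetric, zero on the diagonal, and satisfies $\sum_{y\in X}\mu_{xy}<\infty$ for all $x\in X$ (local finiteness is not assumed). Write $x\sim y$ if $\mu_{xy}>0$. The graph is connected if any two vertices $x,y$ are joined by a path $x=x_0\sim x_1\sim\dots\sim x_n=y$. Subharmonic: let $F(X)=\{f:X\to\mathbb{R}\mid \sum_{y\in X}\mu_{xy}|f(y)|<\infty \text{ for all }x\in X\}$ and $\Delta f(x)=\frac1{m(x)}\sum_{y\in X}\mu_{xy}(f(x)-f(y))$ for $f\in F(X)$. A function $f:X\to\mathbb{R}$ is subharmonic if $f\in F(X)$ and $\Delta f\le 0$ pointwise. Compatible intrinsic metric: a pseudo metric is a symmetric map $\rho:X\times X\to[0,\infty)$ with zero diagonal satisfying the triangle inequality. It is intrinsic if $\sum_{y\in X}\mu_{xy}\rho^2(x,y)\le m(x)$ for all $x\in X$. Its jump size is $s=\sup\{\rho(x,y)\mid x\sim y\}$. The weighted vertex degree is $\mathrm{Deg}(x)=\frac1{m(x)}\sum_{y\in X}\mu_{xy}$. A pseudo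 metric is compatible if $s<\infty$ and $\mathrm{Deg}$ is bounded on each ball $B_r=\{x\mid\rho(x,o)\le r\}$, $r\ge0$. Notation: $a\vee b=\max(a,b)$; $f\in L^p(X,m\rho_1^{-2})$ means $\sum_{x\in X}|f(x)|^p\rho_1(x)^{-2}m(x)<\infty$. *)

theory Defs
  imports "HOL-Analysis.Analysis"
begin

text \<open>
  The vertex set is the whole type \<open>'a\<close>, discrete and countable. All sums over vertices are
  unordered sums. The finiteness of a sum of non-negative reals is its summability, which is
  stated separately because a divergent real-valued \<open>infsum\<close> has the value 0.
\<close>

locale weighted_graph =
  fixes m :: "'a \<Rightarrow> real"
    and \<mu> :: "'a \<Rightarrow> 'a \<Rightarrow> real"
  assumes countable_vertices: "countable (UNIV :: 'a set)"
    and m_pos: "m x > 0"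
    and mu_nonneg: "\<mu> x y \<ge> 0"
    and mu_sym: "\<mu> x y = \<mu> y x"
    and mu_diag: "\<mu> x x = 0"
    and mu_summable: "(\<lambda>y. \<mu> x y) summable_on UNIV"

definition adjacent :: "('a \<Rightarrow> 'a \<Rightarrow> real) \<Rightarrow> 'a \<Rightarrow> 'a \<Rightarrow> bool" where
  "adjacent \<mu> x y \<longleftrightarrow> \<mu> x y > 0"

definition connected_graph :: "('a \<Rightarrow> 'a \<Rightarrow> real) \<Rightarrow> bool" where
  "connected_graph \<mu> \<longleftrightarrow> (\<forall>x y. rtranclp (adjacent \<mu>) x y)"

definition formal_domain :: "('a \<Rightarrow> 'a \<Rightarrow> real) \<Rightarrow> ('a \<Rightarrow> real) set" where
  "formal_domain \<mu> = {f. \<forall>x. (\<lambda>y. \<mu> x y * \<bar>f y\<bar>) summable_on UNIV}"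

definition laplacian :: "('a \<Rightarrow> real) \<Rightarrow> ('a \<Rightarrow> 'a \<Rightarrow> real) \<Rightarrow> ('a \<Rightarrow> real) \<Rightarrow> 'a \<Rightarrow> real" where
  "laplacian m \<mu> f x = 1 / m x * (\<Sum>\<^sub>\<infinity>y. \<mu> x y * (f x - f y))"

definition subharmonic :: "('a \<Rightarrow> real) \<Rightarrow> ('a \<Rightarrow> 'a \<Rightarrow> real) \<Rightarrow> ('a \<Rightarrow> real) \<Rightarrow> bool" where
  "subharmonic m \<mu> f \<longleftrightarrow> f \<in> formal_domain \<mu> \<and> (\<forall>x. laplacian m \<mu> f x \<le> 0)"

definition pseudo_metric :: "('a \<Rightarrow> 'a \<Rightarrow> real) \<Rightarrow> bool" where
  "pseudo_metric \<rho> \<longleftrightarrow>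
     (\<forall>x y. \<rho> x y \<ge> 0) \<and> (\<forall>x. \<rho> x x = 0) \<and> (\<forall>x y. \<rho> x y = \<rho> y x) \<and>
     (\<forall>x y z. \<rho> x z \<le> \<rho> x y + \<rho> y z)"

definition intrinsic ::
  "('a \<Rightarrow> real) \<Rightarrow> ('a \<Rightarrow> 'a \<Rightarrow> real) \<Rightarrow> ('a \<Rightarrow> 'a \<Rightarrow> real) \<Rightarrow> bool" where
  "intrinsic m \<mu> \<rho> \<longleftrightarrow>
     (\<forall>x. (\<lambda>y. \<mu> x y * (\<rho> x y)\<^sup>2) summable_on UNIV \<and>
          (\<Sum>\<^sub>\<infinity>y. \<mu> x y * (\<rho> x y)\<^sup>2) \<le> m x)"

text \<open>Extended-valued, so that the supremum always exists (it is 0 for a graph without edges).\<close>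

definition jump_size :: "('a \<Rightarrow> 'a \<Rightarrow> real) \<Rightarrow> ('a \<Rightarrow> 'a \<Rightarrow> real) \<Rightarrow> ennreal" where
  "jump_size \<mu> \<rho> = Sup {ennreal (\<rho> x y) | x y. adjacent \<mu> x y}"

definition vertex_degree :: "('a \<Rightarrow> real) \<Rightarrow> ('a \<Rightarrow> 'a \<Rightarrow> real) \<Rightarrow> 'a \<Rightarrow> real" where
  "vertex_degree m \<mu> x = 1 / m x * (\<Sum>\<^sub>\<infinity>y. \<mu> x y)"

definition distance_ball :: "('a \<Rightarrow> 'a \<Rightarrow> real) \<Rightarrow> 'a \<Rightarrow> real \<Rightarrow> 'a set" where
  "distance_ball \<rho> x\<^sub>0 r = {x. \<rho> x x\<^sub>0 \<le> r}"

text \<open>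
  The balls are centred at the fixed vertex \<open>x\<^sub>0\<close>. By the triangle inequality the condition on
  the degree does not depend on the choice of this vertex. The degree is non-negative, so
  bounded means bounded above.
\<close>

definition compatible ::
  "('a \<Rightarrow> real) \<Rightarrow> ('a \<Rightarrow> 'a \<Rightarrow> real) \<Rightarrow> 'a \<Rightarrow> ('a \<Rightarrow> 'a \<Rightarrow> real) \<Rightarrow> bool" where
  "compatible m \<mu> x\<^sub>0 \<rho> \<longleftrightarrow>
     jump_size \<mu> \<rho> < \<infinity> \<and>
     (\<forall>r\<ge>0. bdd_above (vertex_degree m \<mu> ` distance_ball \<rho> x\<^sub>0 r))"

definition rho1 :: "('a \<Rightarrow> 'a \<Rightarrow> real) \<Rightarrow> 'a \<Rightarrow> 'a \<Rightarrow> real" where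
  "rho1 \<rho> x\<^sub>0 x = max 1 (\<rho> x x\<^sub>0)"

text \<open>The space of functions whose \<open>p\<close>-th power is summable against the vertex weight \<open>w\<close>.\<close>

definition weighted_Lp :: "real \<Rightarrow> ('a \<Rightarrow> real) \<Rightarrow> ('a \<Rightarrow> real) set" where
  "weighted_Lp p w = {f. (\<lambda>x. \<bar>f x\<bar> powr p * w x) summable_on UNIV}"

end

theory Submission
  imports Defs
begin

text \<open>
  The proof is a Caccioppoli estimate. Let \<open>\<phi>\<close> be a cutoff function with values in \<open>[0, 1]\<close>. Testing
  \<open>\<Delta>f \<le> 0\<close> against \<open>f powr (p - 1) * \<phi>\<^sup>2\<close>, with Green's formula, gives
  \<open>\<Sum>\<^sub>x\<^sub>,\<^sub>y \<mu>\<^sub>x\<^sub>y (f(x) - f(y)) (f(x)\<^sup>p\<^sup>-\<^sup>1 \<phi>(x)\<^sup>2 - f(y)\<^sup>p\<^sup>-\<^sup>1 \<phi>(y)\<^sup>2) \<le> 0\<close>.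
  Each summand is bounded below by \<open>-C \<mu>\<^sub>x\<^sub>y (f(x)\<^sup>p + f(y)\<^sup>p) (\<phi>(x) - \<phi>(y))\<^sup>2\<close>, where \<open>C\<close> depends on \<open>p\<close>
  only (lemma \<open>cutoff_product_lower_bound\<close>). After adding these error terms all summands are
  non-negative, so each single one is at most the total error, that is,
  \<open>2 C \<Sum>\<^sub>x f(x)\<^sup>p \<Sum>\<^sub>y \<mu>\<^sub>x\<^sub>y (\<phi>(x) - \<phi>(y))\<^sup>2\<close>. For an edge \<open>uv\<close> on which \<open>\<phi> = 1\<close> the summand is the energy
  \<open>\<mu>\<^sub>u\<^sub>v (f(u) - f(v)) (f(u)\<^sup>p\<^sup>-\<^sup>1 - f(v)\<^sup>p\<^sup>-\<^sup>1)\<close> (lemma \<open>subharmonic_edge_energy_bound\<close>).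

  Take \<open>\<phi>\<close> equal to 1 on the ball of radius \<open>R\<close>, equal to 0 off the ball of radius \<open>2R\<close>, and
  \<open>1/R\<close>-Lipschitz for \<open>\<rho>\<close>. Since \<open>\<rho>\<close> is intrinsic, the inner sum is at most \<open>m(x)/R\<^sup>2\<close>. Since jumps are
  bounded by some \<open>s\<close>, it vanishes unless \<open>R - s < \<rho>(x, x\<^sub>0) \<le> 3R\<close> as soon as \<open>R \<ge> s\<close>, and there
  \<open>1/R\<^sup>2 \<le> 9/\<rho>\<^sub>1(x)\<^sup>2\<close>. So the error is a constant times a tail of the convergent sum
  \<open>\<Sum>\<^sub>x f(x)\<^sup>p m(x)/\<rho>\<^sub>1(x)\<^sup>2\<close> and tends to 0 as \<open>R\<close> grows. Hence every edge has zero energy, \<open>f\<close>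
  agrees at its two ends because \<open>p > 1\<close>, and connectedness makes \<open>f\<close> constant.

  Balls may be infinite, so Green's formula needs absolute convergence of the double sum. This is
  where the bound on the degree enters: on the ball of radius \<open>3R\<close> it makes
  \<open>f(x)\<^sup>p \<Sum>\<^sub>y \<mu>\<^sub>x\<^sub>y\<close> at most a constant multiple of \<open>f(x)\<^sup>p m(x)/\<rho>\<^sub>1(x)\<^sup>2\<close>, which is summable.
\<close>

section \<open>A pointwise inequality for cut-off powers\<close>

text \<open>
  By homogeneity this is \<open>1 - t \<le> max 1 (1/q) * (1 - t powr q)\<close> for \<open>t = b/a\<close>. For \<open>q \<ge> 1\<close> the
  power \<open>t powr q\<close> is at most \<open>t\<close>; for \<open>q < 1\<close> it lies below its tangent at 1. It bounds the
  increment of \<open>f\<close> by that of \<open>f powr q\<close>, so that the error term below can be absorbed for all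
  \<open>q > 0\<close>, also for \<open>q < 1\<close>.
\<close>

lemma powr_difference_lower_bound:
  fixes a b q :: real
  assumes "0 < q" "0 \<le> b" "b \<le> a"
  shows "(a - b) * a powr q \<le> max 1 (1 / q) * (a powr q - b powr q) * a"
proof (cases "b = 0")
  case True
  then show ?thesis
    using assms mult_right_mono[of 1 "max 1 (1 / q)" "a * a powr q"]
    by (simp add: mult.commute mult.left_commute)
next
  case False
  then have "b > 0" "a > 0"
    using assms by auto
  define t where "t = b / a"
  have t: "0 < t" "t \<le> 1" and b: "b = t * a"
    using \<open>b > 0\<close> \<open>a > 0\<close> assms by (auto simp: t_def)
  have key: "1 - t \<le> max 1 (1 / q) * (1 - t powr q)"
  proof (cases "q \<ge> 1")
    case True
    then have "t powr q \<le> t powr 1"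
      using t by (intro powr_mono') auto
    then have "1 - t \<le> 1 - t powr q"
      using t by simp
    with True t show ?thesis
      by (simp add: max_def field_simps)
  next
    case False
    have "t powr q * 1 powr (1 - q) \<le> q * t + (1 - q) * 1"
      using t False assms by (intro Youngs_inequality_0) auto
    then have "q * (1 - t) \<le> 1 - t powr q"
      by (simp add: algebra_simps)
    then have "1 - t \<le> 1 / q * (1 - t powr q)"
      using assms by (simp add: field_simps)
    with False assms show ?thesis
      by (simp add: max_def field_simps)
  qed
  have "(a - b) * a powr q = (1 - t) * (a * a powr q)"
    by (simp add: b algebra_simps)
  also have "\<dots> \<le> (max 1 (1 / q) * (1 - t powr q)) * (a * a powr q)"
    using key \<open>a > 0\<close> by (intro mult_right_mono) auto
  also have "\<dots> = max 1 (1 / q) * (a powr q - b powr q) * a"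
    using t \<open>a > 0\<close> by (simp add: b powr_mult algebra_simps)
  finally show ?thesis .
qed

text \<open>
  If \<open>\<beta> \<le> \<alpha>\<close>, already the first summand is non-negative. Otherwise the cutoff grows where the value
  falls, and the loss \<open>(a - b) * a powr q * (\<beta>\<^sup>2 - \<alpha>\<^sup>2)\<close> is split by the inequality of arithmetic and
  geometric means: one part is absorbed in the energy
  \<open>(a - b) * (a powr q - b powr q) * \<beta>\<^sup>2\<close>, the other is the second summand.
\<close>

lemma cutoff_product_lower_bound_ordered:
  fixes a b q \<alpha> \<beta> :: real
  assumes "0 < q" "0 \<le> b" "b \<le> a" "0 \<le> \<alpha>" "0 \<le> \<beta>"
  shows "0 \<le> (a - b) * (a powr q * \<alpha>\<^sup>2 - b powr q * \<beta>\<^sup>2)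
            + max 1 (1 / q) * (a powr (q + 1) * (\<alpha> - \<beta>)\<^sup>2)"
proof -
  define C E where "C = max 1 (1 / q)" and "E = a powr q - b powr q"
  have "0 < C" "0 \<le> E" "0 \<le> a" "0 \<le> a - b"
    using assms by (auto simp: C_def E_def intro: powr_mono2)
  have ap: "a powr (q + 1) = a powr q * a"
    using \<open>0 \<le> a\<close> by (auto simp: powr_add)
  show ?thesis
  proof (cases "\<beta> \<le> \<alpha>")
    case True
    then have "b powr q * \<beta>\<^sup>2 \<le> a powr q * \<alpha>\<^sup>2"
      using assms by (intro mult_mono powr_mono2 power_mono) auto
    then have "0 \<le> (a - b) * (a powr q * \<alpha>\<^sup>2 - b powr q * \<beta>\<^sup>2)"
      using assms by auto
    moreover have "0 \<le> C * (a powr (q + 1) * (\<alpha> - \<beta>)\<^sup>2)"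
      using \<open>0 < C\<close> by simp
    ultimately show ?thesis
      unfolding C_def by linarith
  next
    case False
    define \<delta> where "\<delta> = \<beta> - \<alpha>"
    have \<delta>: "0 < \<delta>" "\<delta> \<le> \<beta>" "\<alpha> = \<beta> - \<delta>"
      using False assms by (auto simp: \<delta>_def)
    define A where "A = a powr q"
    have "A \<ge> 0" by (simp add: A_def)
    have key: "(a - b) * A \<le> C * E * a"
      using powr_difference_lower_bound[of q b a] assms by (simp add: C_def E_def A_def)
    show ?thesis
    proof (cases "a = b")
      case True
      then show ?thesis
        using \<open>0 < C\<close> by (simp add: C_def)
    next
      case neq: False
      have "0 < a - b" "0 < a"
        using neq assms by auto
      then have "A > 0" by (simp add: A_def)
      have low: "E \<ge> (a - b) * A / (C * a)"
        using key \<open>0 < C\<close> \<open>0 < a\<close> by (simp add: field_simps)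
      \<comment> \<open>With \<open>2\<beta>\<delta> - \<delta>\<^sup>2 \<le> 2\<beta>\<delta>\<close>, what remains is a quadratic form in \<open>\<beta>\<close> and \<open>\<delta>\<close> that is a
        perfect square.\<close>
      have "(a - b) * (A * \<alpha>\<^sup>2 - b powr q * \<beta>\<^sup>2)
            = (a - b) * (E * \<beta>\<^sup>2 - A * (2 * \<beta> * \<delta> - \<delta>\<^sup>2))"
        by (simp add: E_def A_def \<delta>(3) power2_eq_square algebra_simps)
      also have "\<dots> \<ge> (a - b) * (((a - b) * A / (C * a)) * \<beta>\<^sup>2 - A * (2 * \<beta> * \<delta>))"
      proof -
        have "(a - b) * A / (C * a) * \<beta>\<^sup>2 \<le> E * \<beta>\<^sup>2"
          using low by (intro mult_right_mono) auto
        moreover have "A * (2 * \<beta> * \<delta> - \<delta>\<^sup>2) \<le> A * (2 * \<beta> * \<delta>)"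
          using \<open>A \<ge> 0\<close> by (intro mult_left_mono) auto
        ultimately show ?thesis
          using \<open>0 < a - b\<close> by (intro mult_left_mono) linarith+
      qed
      finally have "(a - b) * (A * \<alpha>\<^sup>2 - b powr q * \<beta>\<^sup>2)
            \<ge> (a - b) * (((a - b) * A / (C * a)) * \<beta>\<^sup>2 - A * (2 * \<beta> * \<delta>))" .
      moreover have "(a - b) * (((a - b) * A / (C * a)) * \<beta>\<^sup>2 - A * (2 * \<beta> * \<delta>))
            + C * (A * a * \<delta>\<^sup>2) = A / (C * a) * ((a - b) * \<beta> - C * a * \<delta>)\<^sup>2"
        using \<open>0 < C\<close> \<open>0 < a\<close> by (simp add: power2_eq_square field_simps)
      moreover have "0 \<le> A / (C * a) * ((a - b) * \<beta> - C * a * \<delta>)\<^sup>2"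
        using \<open>0 < C\<close> \<open>0 < a\<close> \<open>0 \<le> A\<close> by simp
      moreover have "a powr (q + 1) * (\<alpha> - \<beta>)\<^sup>2 = A * a * \<delta>\<^sup>2"
        by (simp add: ap A_def \<delta>_def power2_commute)
      ultimately show ?thesis
        unfolding C_def[symmetric] A_def[symmetric] by simp
    qed
  qed
qed

lemma cutoff_product_lower_bound:
  fixes a b q \<alpha> \<beta> :: real
  assumes "0 < q" "0 \<le> a" "0 \<le> b" "0 \<le> \<alpha>" "0 \<le> \<beta>"
  shows "0 \<le> (a - b) * (a powr q * \<alpha>\<^sup>2 - b powr q * \<beta>\<^sup>2)
            + max 1 (1 / q) * ((a powr (q + 1) + b powr (q + 1)) * (\<alpha> - \<beta>)\<^sup>2)"
proof -
  define C where "C = max 1 (1 / q)"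
  have "0 \<le> C * (a powr (q + 1) * (\<alpha> - \<beta>)\<^sup>2)" "0 \<le> C * (b powr (q + 1) * (\<alpha> - \<beta>)\<^sup>2)"
    by (auto simp: C_def)
  then show ?thesis
    using cutoff_product_lower_bound_ordered[of q b a \<alpha> \<beta>]
      cutoff_product_lower_bound_ordered[of q a b \<beta> \<alpha>] assms
    unfolding C_def[symmetric] power2_commute[of \<beta> \<alpha>]
    by (cases "b \<le> a") (simp_all add: algebra_simps)
qed

section \<open>Double sums\<close>

lemma nonneg_double_sum_bound:
  fixes K :: "'a \<Rightarrow> 'b \<Rightarrow> real" and k :: "'a \<Rightarrow> real"
  assumes nonneg: "\<And>x y. 0 \<le> K x y"
    and row: "\<And>x. K x summable_on UNIV"
    and row_le: "\<And>x. (\<Sum>\<^sub>\<infinity>y. K x y) \<le> k x"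
    and k: "k summable_on UNIV"
  shows "(\<lambda>(x, y). K x y) summable_on UNIV"
    and "(\<Sum>\<^sub>\<infinity>(x, y). K x y) \<le> (\<Sum>\<^sub>\<infinity>x. k x)"
proof -
  have rows: "(\<lambda>x. \<Sum>\<^sub>\<infinity>y. K x y) summable_on UNIV"
    using k row_le by (rule summable_on_comparison_test) (auto intro: infsum_nonneg nonneg)
  have "(\<lambda>(x, y). K x y) summable_on (UNIV \<times> UNIV)"
    by (rule summable_on_SigmaI[where g = "\<lambda>x. \<Sum>\<^sub>\<infinity>y. K x y"])
      (auto simp: row rows nonneg)
  then show sum: "(\<lambda>(x, y). K x y) summable_on UNIV"
    by simp
  have "(\<Sum>\<^sub>\<infinity>(x, y). K x y) = (\<Sum>\<^sub>\<infinity>x. \<Sum>\<^sub>\<infinity>y. K x y)"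
    using infsum_Sigma'_banach[of K UNIV "\<lambda>_. UNIV"] sum by simp
  also have "\<dots> \<le> (\<Sum>\<^sub>\<infinity>x. k x)"
    using rows k row_le by (rule infsum_mono)
  finally show "(\<Sum>\<^sub>\<infinity>(x, y). K x y) \<le> (\<Sum>\<^sub>\<infinity>x. k x)" .
qed

lemma has_sum_symmetrize:
  fixes F :: "'a \<Rightarrow> 'a \<Rightarrow> real"
  assumes "(\<lambda>(x, y). F x y) summable_on UNIV"
  shows "((\<lambda>(x, y). F x y + F y x) has_sum 2 * (\<Sum>\<^sub>\<infinity>(x, y). F x y)) UNIV"
proof -
  have s: "((\<lambda>(x, y). F x y) has_sum (\<Sum>\<^sub>\<infinity>(x, y). F x y)) (UNIV \<times> UNIV)"
    using assms by simp
  then have "((\<lambda>(x, y). F y x) has_sum (\<Sum>\<^sub>\<infinity>(x, y). F x y)) (UNIV \<times> UNIV)"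
    by (subst (asm) has_sum_swap) simp
  from has_sum_add[OF s this] show ?thesis
    by (simp add: case_prod_unfold)
qed

section \<open>Consequences of compatibility and summability\<close>

lemma compatible_jump_bound:
  assumes "compatible m \<mu> x\<^sub>0 \<rho>"
  obtains s where "0 \<le> s" "\<And>x y. 0 < \<mu> x y \<Longrightarrow> \<rho> x y \<le> s"
proof
  have fin: "jump_size \<mu> \<rho> < \<infinity>"
    using assms by (simp add: compatible_def)
  show "0 \<le> enn2real (jump_size \<mu> \<rho>)"
    by simp
  show "\<rho> x y \<le> enn2real (jump_size \<mu> \<rho>)" if "0 < \<mu> x y" for x y
  proof -
    have "ennreal (\<rho> x y) \<le> jump_size \<mu> \<rho>"
      unfolding jump_size_def using that by (intro Sup_upper) (auto simp: adjacent_def)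
    also have "\<dots> = ennreal (enn2real (jump_size \<mu> \<rho>))"
      using fin by (simp add: less_top)
    finally show ?thesis
      by (simp add: ennreal_le_iff)
  qed
qed

lemma summable_on_small_tail:
  fixes w :: "'a \<Rightarrow> real"
  assumes "w summable_on UNIV" "0 < \<epsilon>"
  obtains A where "finite A" "(\<Sum>\<^sub>\<infinity>x. if x \<in> A then 0 else w x) \<le> \<epsilon>"
proof -
  obtain A where A: "finite A" "dist (sum w A) (infsum w UNIV) \<le> \<epsilon>"
    using infsum_finite_approximation[OF assms] by blast
  have "(\<Sum>\<^sub>\<infinity>x. if x \<in> A then 0 else w x) = infsum w (UNIV - A)"
    by (rule infsum_cong_neutral) auto
  also have "\<dots> = infsum w UNIV - sum w A"
    using assms A by (subst infsum_Diff) auto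
  also have "\<dots> \<le> \<epsilon>"
    using A by (simp add: dist_real_def)
  finally show ?thesis
    using that A by blast
qed

section \<open>The Caccioppoli estimate\<close>

context weighted_graph
begin

text \<open>
  The estimate for a general cutoff \<open>\<phi>\<close>, stated for one edge instead of the whole energy. The set
  \<open>B\<close> contains the support of \<open>\<phi>\<close> and all neighbours of it; \<open>deg\<close> says that the \<open>p\<close>-th power of
  \<open>f\<close> is summable on \<open>B\<close> even against the total edge weight, which makes the sums below absolutely
  convergent. The function \<open>k\<close> bounds the squared gradient of \<open>\<phi>\<close>.
\<close>

lemma subharmonic_edge_energy_bound:
  fixes f \<phi> k :: "'a \<Rightarrow> real" and p :: real and B :: "'a set"
  assumes p: "1 < p"
    and f_nonneg: "\<And>x. 0 \<le> f x"
    and sub: "subharmonic m \<mu> f"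
    and \<phi>: "\<And>x. 0 \<le> \<phi> x" "\<And>x. \<phi> x \<le> 1"
    and supp: "\<And>x. \<phi> x \<noteq> 0 \<Longrightarrow> x \<in> B"
    and supp_nbr: "\<And>x y. \<phi> x \<noteq> 0 \<Longrightarrow> 0 < \<mu> x y \<Longrightarrow> y \<in> B"
    and deg: "(\<lambda>x. indicator B x * f x powr p * (\<Sum>\<^sub>\<infinity>y. \<mu> x y)) summable_on UNIV"
    and grad: "\<And>x. (\<lambda>y. \<mu> x y * (\<phi> x - \<phi> y)\<^sup>2) summable_on UNIV"
      "\<And>x. (\<Sum>\<^sub>\<infinity>y. \<mu> x y * (\<phi> x - \<phi> y)\<^sup>2) \<le> k x"
    and err: "(\<lambda>x. f x powr p * k x) summable_on UNIV"
    and one: "\<phi> u = 1" "\<phi> v = 1"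
  shows "\<mu> u v * ((f u - f v) * (f u powr (p - 1) - f v powr (p - 1)))
           \<le> 2 * max 1 (1 / (p - 1)) * (\<Sum>\<^sub>\<infinity>x. f x powr p * k x)"
proof -
  define q C where "q = p - 1" and "C = max 1 (1 / q)"
  have q: "0 < q" "p = q + 1" and C: "0 \<le> C"
    using p by (auto simp: q_def C_def)
  have powr_split: "f x powr p = f x powr q * f x" for x
    using f_nonneg[of x] by (auto simp: q(2) powr_add)

  \<comment> \<open>\<open>H x y + H y x\<close> is the summable majorant for Green's formula.\<close>
  define H where "H x y = \<mu> x y * (indicator B x * f x powr p)" for x y
  have H_nonneg: "0 \<le> H x y" for x y
    by (simp add: H_def mu_nonneg)
  have H_sum: "(\<lambda>(x, y). H x y) summable_on UNIV"
  proof (rule nonneg_double_sum_bound(1)[OF H_nonneg])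
    show "H x summable_on UNIV" for x
      unfolding H_def by (rule summable_on_cmult_left) (rule mu_summable)
    show "(\<Sum>\<^sub>\<infinity>y. H x y) \<le> indicator B x * f x powr p * (\<Sum>\<^sub>\<infinity>y. \<mu> x y)" for x
      unfolding H_def by (simp add: infsum_cmult_left' mult.commute)
  qed (rule deg)
  have H: "(\<lambda>(x, y). H x y + H y x) summable_on UNIV"
    by (rule has_sum_imp_summable[OF has_sum_symmetrize[OF H_sum]])

  \<comment> \<open>\<open>C * (G x y + G y x)\<close> is the error term of the pointwise inequality.\<close>
  define G where "G x y = f x powr p * (\<mu> x y * (\<phi> x - \<phi> y)\<^sup>2)" for x y
  have G_nonneg: "0 \<le> G x y" for x y
    by (simp add: G_def mu_nonneg)
  have G_row: "G x summable_on UNIV" for x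
    unfolding G_def by (rule summable_on_cmult_right) (rule grad)
  have G_row_le: "(\<Sum>\<^sub>\<infinity>y. G x y) \<le> f x powr p * k x" for x
    unfolding G_def infsum_cmult_right' by (rule mult_left_mono) (auto intro: grad)
  note G = nonneg_double_sum_bound[OF G_nonneg G_row G_row_le err]

  \<comment> \<open>The row sums of \<open>F\<close> are \<open>\<Delta>f\<close> times the test function and the positive weight \<open>m\<close>;
    its symmetrization is the energy form of \<open>f\<close> and the test function.\<close>
  define F where "F x y = \<mu> x y * ((f x - f y) * (f x powr q * (\<phi> x)\<^sup>2))" for x y
  have F_le: "\<bar>F x y\<bar> \<le> H x y + H y x" for x y
  proof (cases "\<phi> x = 0 \<or> \<mu> x y = 0")
    case True
    then show ?thesis
      using H_nonneg[of x y] H_nonneg[of y x] by (auto simp: F_def)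
  next
    case False
    then have "0 < \<mu> x y"
      using mu_nonneg[of x y] by auto
    then have xy: "x \<in> B" "y \<in> B"
      using False supp supp_nbr by blast+
    \<comment> \<open>The larger of \<open>f x\<close> and \<open>f y\<close> dominates both factors on the left.\<close>
    have "\<bar>(f x - f y) * f x powr q\<bar> \<le> f x powr p + f y powr p"
    proof (cases "f y \<le> f x")
      case True
      have "\<bar>(f x - f y) * f x powr q\<bar> \<le> f x * f x powr q"
        using True f_nonneg[of y] by (simp add: abs_mult mult_right_mono)
      then show ?thesis
        using f_nonneg by (simp add: powr_split mult.commute add_increasing2)
    next
      case False
      have "\<bar>(f x - f y) * f x powr q\<bar> \<le> f y * f y powr q"
        unfolding abs_mult
        using False f_nonneg[of x] q by (intro mult_mono) (auto intro: powr_mono2)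
      then show ?thesis
        using f_nonneg by (simp add: powr_split mult.commute add_increasing)
    qed
    moreover have "(\<phi> x)\<^sup>2 \<le> 1"
      using \<phi> by (simp add: power_le_one)
    ultimately have "\<bar>(f x - f y) * f x powr q\<bar> * (\<phi> x)\<^sup>2 \<le> (f x powr p + f y powr p) * 1"
      by (intro mult_mono) auto
    then have "\<mu> x y * (\<bar>(f x - f y) * f x powr q\<bar> * (\<phi> x)\<^sup>2) \<le> \<mu> x y * (f x powr p + f y powr p)"
      by (intro mult_left_mono) (auto simp: mu_nonneg)
    then show ?thesis
      using xy mu_sym[of x y]
      by (simp add: F_def H_def abs_mult mu_nonneg distrib_left mult.assoc)
  qed
  have F: "(\<lambda>(x, y). F x y) summable_on UNIV"
  proof -
    have "(\<lambda>z. norm (case z of (x, y) \<Rightarrow> F x y)) summable_on UNIV"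
      by (rule Infinite_Sum.abs_summable_on_comparison_test'[OF H]) (use F_le in auto)
    then show ?thesis
      by (rule summable_on_iff_abs_summable_on_real[THEN iffD2])
  qed
  have "(\<Sum>\<^sub>\<infinity>(x, y). F x y) = (\<Sum>\<^sub>\<infinity>x. \<Sum>\<^sub>\<infinity>y. F x y)"
    using infsum_Sigma'_banach[of F UNIV "\<lambda>_. UNIV"] F by simp
  moreover have "0 \<le> (\<Sum>\<^sub>\<infinity>x. - (\<Sum>\<^sub>\<infinity>y. F x y))"
  proof (rule infsum_nonneg)
    fix x
    have "laplacian m \<mu> f x \<le> 0"
      using sub by (simp add: subharmonic_def)
    then have "(\<Sum>\<^sub>\<infinity>y. \<mu> x y * (f x - f y)) \<le> 0"
      using m_pos[of x] by (simp add: laplacian_def divide_le_0_iff)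
    moreover have "(\<Sum>\<^sub>\<infinity>y. F x y) = (\<Sum>\<^sub>\<infinity>y. \<mu> x y * (f x - f y)) * (f x powr q * (\<phi> x)\<^sup>2)"
      by (simp add: F_def infsum_cmult_left' flip: mult.assoc)
    ultimately show "0 \<le> - (\<Sum>\<^sub>\<infinity>y. F x y)"
      by (simp add: mult_nonpos_nonneg)
  qed
  ultimately have F_nonpos: "(\<Sum>\<^sub>\<infinity>(x, y). F x y) \<le> 0"
    by (simp add: infsum_uminus)

  define S where "S = (\<lambda>(x, y). (F x y + F y x) + C * (G x y + G y x))"
  have S_sum: "(S has_sum (2 * (\<Sum>\<^sub>\<infinity>(x, y). F x y) + C * (2 * (\<Sum>\<^sub>\<infinity>(x, y). G x y)))) UNIV"
    using has_sum_add[OF has_sum_symmetrize[OF F]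
        has_sum_cmult_right[OF has_sum_symmetrize[OF G(1)], of C]]
    by (simp add: S_def case_prod_unfold)
  have S_eq: "S (x, y) = \<mu> x y * ((f x - f y) * (f x powr q * (\<phi> x)\<^sup>2 - f y powr q * (\<phi> y)\<^sup>2)
      + C * ((f x powr (q + 1) + f y powr (q + 1)) * (\<phi> x - \<phi> y)\<^sup>2))" for x y
    unfolding S_def F_def G_def q(2) mu_sym[of y x] power2_commute[of "\<phi> y" "\<phi> x"] case_prod_conv
    by algebra
  have S_nonneg: "0 \<le> S z" for z
  proof (cases z)
    case (Pair x y)
    then show ?thesis
      using cutoff_product_lower_bound[of q "f x" "f y" "\<phi> x" "\<phi> y"] q f_nonneg \<phi>
      by (simp only: S_eq C_def) (auto intro!: mult_nonneg_nonneg simp: mu_nonneg)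
  qed
  have "\<mu> u v * ((f u - f v) * (f u powr q - f v powr q)) = sum S {(u, v)}"
    by (simp add: S_eq one)
  also have "\<dots> \<le> 2 * (\<Sum>\<^sub>\<infinity>(x, y). F x y) + C * (2 * (\<Sum>\<^sub>\<infinity>(x, y). G x y))"
    using S_nonneg by (intro finite_sum_le_has_sum[OF S_sum]) auto
  also have "\<dots> \<le> C * (2 * (\<Sum>\<^sub>\<infinity>(x, y). G x y))"
    using F_nonpos by simp
  also have "\<dots> \<le> C * (2 * (\<Sum>\<^sub>\<infinity>x. f x powr p * k x))"
    using C G(2) by (intro mult_left_mono) auto
  finally show ?thesis
    by (simp add: C_def q_def mult.commute mult.left_commute)
qed

text \<open>
  The same for the piecewise linear cutoff between the radii \<open>R\<close> and \<open>2R\<close>. On \<open>A\<close>, which stays a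
  jump length away from the outside of the ball of radius \<open>R\<close>, this cutoff has zero gradient, so
  only the part of the sum outside \<open>A\<close> contributes to the error.
\<close>

lemma subharmonic_edge_energy_tail_bound:
  fixes f w :: "'a \<Rightarrow> real" and \<rho> :: "'a \<Rightarrow> 'a \<Rightarrow> real" and p s R :: real and x\<^sub>0 :: 'a and A :: "'a set"
  defines "w \<equiv> \<lambda>x. f x powr p * (m x / (rho1 \<rho> x\<^sub>0 x)\<^sup>2)"
  assumes p: "1 < p"
    and f_nonneg: "\<And>x. 0 \<le> f x"
    and sub: "subharmonic m \<mu> f"
    and metric: "pseudo_metric \<rho>"
    and intrinsic: "intrinsic m \<mu> \<rho>"
    and compat: "compatible m \<mu> x\<^sub>0 \<rho>"
    and s: "0 \<le> s" "\<And>x y. 0 < \<mu> x y \<Longrightarrow> \<rho> x y \<le> s"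
    and w: "w summable_on UNIV"
    and R: "1 \<le> R" "s \<le> R"
    and R_ge: "\<And>x. x \<in> A \<union> {u, v} \<Longrightarrow> \<rho> x x\<^sub>0 + s \<le> R"
  shows "\<mu> u v * ((f u - f v) * (f u powr (p - 1) - f v powr (p - 1)))
           \<le> 18 * max 1 (1 / (p - 1)) * (\<Sum>\<^sub>\<infinity>x. if x \<in> A then 0 else w x)"
proof -
  have \<rho>: "0 \<le> \<rho> x y" "\<rho> x y = \<rho> y x" "\<rho> x z \<le> \<rho> x y + \<rho> y z" for x y z
    using metric unfolding pseudo_metric_def by blast+
  define \<phi> where "\<phi> x = max 0 (min 1 (2 - \<rho> x x\<^sub>0 / R))" for x
  have \<phi>_one: "\<phi> x = 1" if "\<rho> x x\<^sub>0 \<le> R" for x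
    using that R by (simp add: \<phi>_def field_simps)
  have \<phi>_zero: "\<phi> x = 0" if "2 * R \<le> \<rho> x x\<^sub>0" for x
    using that R by (simp add: \<phi>_def field_simps)
  have \<phi>_lip: "(\<phi> x - \<phi> y)\<^sup>2 \<le> (\<rho> x y)\<^sup>2 / R\<^sup>2" for x y
  proof -
    have "\<bar>\<phi> x - \<phi> y\<bar> \<le> \<bar>\<rho> x x\<^sub>0 / R - \<rho> y x\<^sub>0 / R\<bar>"
      unfolding \<phi>_def by linarith
    also have "\<dots> = \<bar>\<rho> x x\<^sub>0 - \<rho> y x\<^sub>0\<bar> / R"
      using R by (simp flip: diff_divide_distrib)
    also have "\<dots> \<le> \<rho> x y / R"
      using \<rho>(3)[of x x\<^sub>0 y] \<rho>(3)[of y x\<^sub>0 x] \<rho>(2)[of x y] R by (intro divide_right_mono) auto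
    finally have "\<bar>\<phi> x - \<phi> y\<bar>\<^sup>2 \<le> (\<rho> x y / R)\<^sup>2"
      by (intro power_mono) auto
    then show ?thesis
      by (simp add: power_divide)
  qed
  have nbr: "\<rho> y x\<^sub>0 \<le> \<rho> x x\<^sub>0 + s" if "0 < \<mu> x y" for x y
    using \<rho>(3)[of y x\<^sub>0 x] \<rho>(2)[of x y] s(2)[OF that] by simp
  have rho1_sq: "(rho1 \<rho> x\<^sub>0 x)\<^sup>2 \<le> 9 * R\<^sup>2" "0 < (rho1 \<rho> x\<^sub>0 x)\<^sup>2" if "\<rho> x x\<^sub>0 \<le> 3 * R" for x
  proof -
    have "1 \<le> rho1 \<rho> x\<^sub>0 x" "rho1 \<rho> x\<^sub>0 x \<le> 3 * R"
      using that R by (auto simp: rho1_def)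
    then show "(rho1 \<rho> x\<^sub>0 x)\<^sup>2 \<le> 9 * R\<^sup>2" "0 < (rho1 \<rho> x\<^sub>0 x)\<^sup>2"
      using power_mono[of "rho1 \<rho> x\<^sub>0 x" "3 * R" 2] by (auto simp: power_mult_distrib)
  qed
  \<comment> \<open>The factor 9 is \<open>(3R)\<^sup>2 / R\<^sup>2\<close>: the gradient lives in the ball of radius \<open>2R + s \<le> 3R\<close>.\<close>
  define k where "k x = (if x \<in> A then 0 else 9 * m x / (rho1 \<rho> x\<^sub>0 x)\<^sup>2)" for x
  have k_eq: "f x powr p * k x = 9 * (if x \<in> A then 0 else w x)" for x
    by (simp add: k_def w_def)
  have tail_sum: "(\<lambda>x. if x \<in> A then 0 else w x) summable_on UNIV"
    using w by (rule summable_on_comparison_test)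
      (auto simp: w_def intro!: mult_nonneg_nonneg divide_nonneg_nonneg less_imp_le[OF m_pos])
  have intr: "(\<lambda>y. \<mu> x y * (\<rho> x y)\<^sup>2) summable_on UNIV"
    "(\<Sum>\<^sub>\<infinity>y. \<mu> x y * (\<rho> x y)\<^sup>2) \<le> m x" for x
    using intrinsic by (auto simp: intrinsic_def)
  have grad_le: "\<mu> x y * (\<phi> x - \<phi> y)\<^sup>2 \<le> \<mu> x y * (\<rho> x y)\<^sup>2 * (1 / R\<^sup>2)" for x y
    using mult_left_mono[OF \<phi>_lip mu_nonneg] by simp
  have intr_R: "(\<lambda>y. \<mu> x y * (\<rho> x y)\<^sup>2 * (1 / R\<^sup>2)) summable_on UNIV" for x
    by (rule summable_on_cmult_left) (rule intr)
  have grad: "(\<lambda>y. \<mu> x y * (\<phi> x - \<phi> y)\<^sup>2) summable_on UNIV" for x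
    using intr_R grad_le by (rule summable_on_comparison_test) (simp add: mu_nonneg)
  have grad_k: "(\<Sum>\<^sub>\<infinity>y. \<mu> x y * (\<phi> x - \<phi> y)\<^sup>2) \<le> k x" for x
  proof (cases "x \<in> A \<or> 3 * R < \<rho> x x\<^sub>0")
    case True
    \<comment> \<open>A neighbour of \<open>x\<close> is at most one jump away, so \<open>\<phi>\<close> is 1 at both ends or 0 at both ends.\<close>
    have "\<mu> x y * (\<phi> x - \<phi> y)\<^sup>2 = 0" for y
    proof (cases "0 < \<mu> x y")
      case adj: True
      have xy: "\<rho> x x\<^sub>0 \<le> \<rho> y x\<^sub>0 + s" "\<rho> y x\<^sub>0 \<le> \<rho> x x\<^sub>0 + s"
        using nbr[of x y] nbr[of y x] adj mu_sym[of x y] by auto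
      from True show ?thesis
      proof
        assume "x \<in> A"
        then show ?thesis
          using R_ge[of x] xy s(1) by (simp add: \<phi>_one)
      next
        assume "3 * R < \<rho> x x\<^sub>0"
        then show ?thesis
          using xy R by (simp add: \<phi>_zero)
      qed
    qed (use mu_nonneg[of x y] in auto)
    then have "(\<Sum>\<^sub>\<infinity>y. \<mu> x y * (\<phi> x - \<phi> y)\<^sup>2) = 0"
      by (intro infsum_0)
    moreover have "0 \<le> k x"
      using m_pos[of x] by (simp add: k_def)
    ultimately show ?thesis
      by simp
  next
    case False
    then have "1 / R\<^sup>2 \<le> 9 / (rho1 \<rho> x\<^sub>0 x)\<^sup>2"
      using rho1_sq[of x] R by (simp add: field_simps)
    have "(\<Sum>\<^sub>\<infinity>y. \<mu> x y * (\<phi> x - \<phi> y)\<^sup>2) \<le> (\<Sum>\<^sub>\<infinity>y. \<mu> x y * (\<rho> x y)\<^sup>2 * (1 / R\<^sup>2))"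
      using grad intr_R grad_le by (rule infsum_mono)
    also have "\<dots> \<le> m x * (1 / R\<^sup>2)"
      unfolding infsum_cmult_left' using intr by (intro mult_right_mono) auto
    also have "\<dots> \<le> m x * (9 / (rho1 \<rho> x\<^sub>0 x)\<^sup>2)"
      using \<open>1 / R\<^sup>2 \<le> _\<close> m_pos[of x] by (intro mult_left_mono) auto
    finally show ?thesis
      using False by (simp add: k_def mult.commute)
  qed
  define B where "B = distance_ball \<rho> x\<^sub>0 (3 * R)"
  have deg: "(\<lambda>x. indicator B x * f x powr p * (\<Sum>\<^sub>\<infinity>y. \<mu> x y)) summable_on UNIV"
  proof -
    obtain D where D: "\<And>x. x \<in> B \<Longrightarrow> vertex_degree m \<mu> x \<le> D"
    proof -
      have "bdd_above (vertex_degree m \<mu> ` B)"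
        using compat R by (simp add: compatible_def B_def)
      then show ?thesis
        by (metis that bdd_above_def imageI)
    qed
    have le: "indicator B x * f x powr p * (\<Sum>\<^sub>\<infinity>y. \<mu> x y) \<le> \<bar>D\<bar> * (9 * R\<^sup>2) * w x" for x
    proof (cases "x \<in> B")
      case True
      then have r: "(rho1 \<rho> x\<^sub>0 x)\<^sup>2 \<le> 9 * R\<^sup>2" "0 < (rho1 \<rho> x\<^sub>0 x)\<^sup>2"
        using rho1_sq[of x] by (auto simp: B_def distance_ball_def)
      have "(\<Sum>\<^sub>\<infinity>y. \<mu> x y) \<le> D * m x"
        using D[OF True] m_pos[of x] by (simp add: vertex_degree_def field_simps)
      also have "\<dots> \<le> \<bar>D\<bar> * m x"
        using m_pos[of x] by (intro mult_right_mono) auto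
      also have "\<dots> \<le> \<bar>D\<bar> * ((9 * R\<^sup>2) * (m x / (rho1 \<rho> x\<^sub>0 x)\<^sup>2))"
        using r m_pos[of x] by (intro mult_left_mono) (auto simp: field_simps)
      finally have "f x powr p * (\<Sum>\<^sub>\<infinity>y. \<mu> x y)
          \<le> f x powr p * (\<bar>D\<bar> * ((9 * R\<^sup>2) * (m x / (rho1 \<rho> x\<^sub>0 x)\<^sup>2)))"
        by (intro mult_left_mono) auto
      then show ?thesis
        using True by (simp add: w_def mult.commute mult.left_commute)
    next
      case False
      then show ?thesis
        using m_pos[of x] by (simp add: w_def)
    qed
    have "(\<lambda>x. \<bar>D\<bar> * (9 * R\<^sup>2) * w x) summable_on UNIV"
      using w by (rule summable_on_cmult_right)
    then show ?thesis
      using le by (rule summable_on_comparison_test)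
        (auto intro!: infsum_nonneg mu_nonneg mult_nonneg_nonneg)
  qed
  have supp: "x \<in> B" if "\<phi> x \<noteq> 0" for x
    using \<phi>_zero[of x] that R by (force simp: B_def distance_ball_def)
  have supp_nbr: "y \<in> B" if "\<phi> x \<noteq> 0" "0 < \<mu> x y" for x y
    using \<phi>_zero[of x] that nbr[of x y] R by (force simp: B_def distance_ball_def)
  have "\<mu> u v * ((f u - f v) * (f u powr (p - 1) - f v powr (p - 1)))
        \<le> 2 * max 1 (1 / (p - 1)) * (\<Sum>\<^sub>\<infinity>x. f x powr p * k x)"
  proof (rule subharmonic_edge_energy_bound[OF p f_nonneg sub _ _ supp supp_nbr deg grad grad_k])
    show "0 \<le> \<phi> x" "\<phi> x \<le> 1" for x
      by (auto simp: \<phi>_def)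
    show "(\<lambda>x. f x powr p * k x) summable_on UNIV"
      unfolding k_eq using tail_sum by (rule summable_on_cmult_right)
    show "\<phi> u = 1" "\<phi> v = 1"
      using R_ge[of u] R_ge[of v] s(1) by (auto intro!: \<phi>_one)
  qed
  also have "\<dots> = 18 * max 1 (1 / (p - 1)) * (\<Sum>\<^sub>\<infinity>x. if x \<in> A then 0 else w x)"
    unfolding k_eq infsum_cmult_right' by simp
  finally show ?thesis .
qed

end

section \<open>The Liouville theorem\<close>

theorem theorem1p10:
  fixes m :: "'a \<Rightarrow> real"
    and \<mu> :: "'a \<Rightarrow> 'a \<Rightarrow> real"
    and \<rho> :: "'a \<Rightarrow> 'a \<Rightarrow> real"
    and x\<^sub>0 :: 'a
    and f :: "'a \<Rightarrow> real"
    and p :: real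
  assumes "weighted_graph m \<mu>"
    and "connected_graph \<mu>"
    and "pseudo_metric \<rho>"
    and "intrinsic m \<mu> \<rho>"
    and "compatible m \<mu> x\<^sub>0 \<rho>"
    and "\<forall>x. f x \<ge> 0"
    and "subharmonic m \<mu> f"
    and "1 < p"
    and "f \<in> weighted_Lp p (\<lambda>x. m x * (1 / (rho1 \<rho> x\<^sub>0 x)\<^sup>2))"
  shows "f constant_on UNIV"
proof -
  interpret weighted_graph m \<mu> by fact
  have f_nonneg: "0 \<le> f x" for x
    using assms by blast
  obtain s where s: "0 \<le> s" "\<And>x y. 0 < \<mu> x y \<Longrightarrow> \<rho> x y \<le> s"
    using compatible_jump_bound[OF \<open>compatible m \<mu> x\<^sub>0 \<rho>\<close>] by blast
  define w where "w x = f x powr p * (m x / (rho1 \<rho> x\<^sub>0 x)\<^sup>2)" for x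
  have w: "w summable_on UNIV"
    using \<open>f \<in> weighted_Lp p _\<close> f_nonneg by (simp add: weighted_Lp_def w_def[abs_def])
  have edge: "f u = f v" if uv: "0 < \<mu> u v" for u v
  proof -
    define E C where "E = (f u - f v) * (f u powr (p - 1) - f v powr (p - 1))"
      and "C = max 1 (1 / (p - 1))"
    have "C > 0"
      by (simp add: C_def)
    have "\<mu> u v * E \<le> 0 + \<epsilon>" if "\<epsilon> > 0" for \<epsilon>
    proof -
      have "\<epsilon> / (18 * C) > 0"
        using \<open>\<epsilon> > 0\<close> \<open>C > 0\<close> by simp
      then obtain A where A: "finite A" and tail: "(\<Sum>\<^sub>\<infinity>x. if x \<in> A then 0 else w x) \<le> \<epsilon> / (18 * C)"
        using summable_on_small_tail[OF w] by blast
      \<comment> \<open>A radius for which the cutoff is 1 on \<open>A\<close>, at \<open>u\<close> and \<open>v\<close>, and at all their neighbours.\<close>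
      define R where "R = Max (insert 1 ((\<lambda>x. \<rho> x x\<^sub>0) ` (A \<union> {u, v}))) + s"
      have R_ge: "\<rho> x x\<^sub>0 + s \<le> R" if "x \<in> A \<union> {u, v}" for x
        unfolding R_def using A that by (intro add_right_mono Max_ge) auto
      have "1 \<le> Max (insert 1 ((\<lambda>x. \<rho> x x\<^sub>0) ` (A \<union> {u, v})))"
        using A by (intro Max_ge) auto
      then have R: "1 \<le> R" "s \<le> R"
        using s by (auto simp: R_def)
      have "\<mu> u v * E \<le> 18 * C * (\<Sum>\<^sub>\<infinity>x. if x \<in> A then 0 else w x)"
        unfolding E_def C_def w_def
        by (rule subharmonic_edge_energy_tail_bound[OF \<open>1 < p\<close> f_nonneg \<open>subharmonic m \<mu> f\<close>
              \<open>pseudo_metric \<rho>\<close> \<open>intrinsic m \<mu> \<rho>\<close> \<open>compatible m \<mu> x\<^sub>0 \<rho>\<close> s w[unfolded w_def[abs_def]] R R_ge])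
      also have "\<dots> \<le> \<epsilon>"
        using tail \<open>C > 0\<close> by (simp add: field_simps)
      finally show ?thesis
        by simp
    qed
    then have "\<mu> u v * E \<le> 0"
      by (rule field_le_epsilon)
    then have "E \<le> 0"
      using uv by (simp add: mult_le_0_iff)
    have strict: "0 < (a - b) * (a powr (p - 1) - b powr (p - 1))" if "0 \<le> b" "b < a" for a b
      using that \<open>1 < p\<close> powr_less_mono2[of "p - 1" b a] by simp
    show ?thesis
    proof (rule ccontr)
      assume "f u \<noteq> f v"
      then consider "f u < f v" | "f v < f u"
        by linarith
      then have "0 < E"
      proof cases
        case 1
        then have "0 < (f v - f u) * (f v powr (p - 1) - f u powr (p - 1))"
          using strict f_nonneg by blast
        then show ?thesis
          by (simp add: E_def algebra_simps)
      next
        case 2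
        then show ?thesis
          unfolding E_def using strict f_nonneg by blast
      qed
      with \<open>E \<le> 0\<close> show False
        by simp
    qed
  qed
  have "f x = f x\<^sub>0" for x
  proof -
    have "(adjacent \<mu>)\<^sup>*\<^sup>* x x\<^sub>0"
      using \<open>connected_graph \<mu>\<close> by (simp add: connected_graph_def)
    then show ?thesis
      by induction (auto simp: adjacent_def edge)
  qed
  then show ?thesis
    by (auto simp: constant_on_def)
qed

end
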